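(* Let $\mathcal A$ be a well-structured set of quantum assertions and $\mathrm{PS}$ a Hoare-type proof system for quantum while-programs with assertions from $\mathcal A$ as described in the context, and consider the abstract interpretation induced by $\mathrm{PS}$. (1) If $\mathrm{PS}$ is sound, then for every program $S$, $\llbracket S\rrbracket^\#$ is a sound abstraction of $\llbracket S\rrbracket$. (2) If $\mathrm{PS}$ is sound and relatively complete, then for every program $S$, $\llbracket S\rrbracket^\#$ is a complete abstraction of $\llbracket S\rrbracket$, i.e. $\alpha\circ\llbracket S\rrbracket=\llbracket S\rrbracket^\#\circ\alpha$ on $\mathcal Q$.
   Context: Fix a finite set $V$ of quantum variables, each a qubit with state space $\mathcal H_q\cong\mathbb C^2$; for $W\subseteq V$, $\mathcal H_W=\bigotimes_{q\in W}\mathcal H_q$. Operators and subspaces on $\mathcal H_W$ are identified with their cylindrical extensions to $\mathcal H_V$, and a subspace is identified with its orthogonal projector; $P^\perp$ is the orthocomplement. $\mathcal D(\mathcal H_V)$ is the set of partial density operators (positive, trace $\le1$). Programs: $S::=\mathbf{skip}\mid \bar q:=|0\rangle\mid \bar q\mathrel{*{=}}U\mid \mathbf{assert}\ P[\bar q]\mid S_0;S_1\mid \mathbf{if}\ P[\bar q]\ \mathbf{then}\ S_1\ \mathbf{else}\ S_0\ \mathbf{end}\mid\mathbf{while}\ P[\bar q]\ \mathbf{do}\ S\ \mathbf{end}$, with $\bar q=q_1,\dots,q_t$ distinct variables, $U$ unitary on $\mathcal H_{\bar q}$, $P$ a subspace of $\mathcal H_{\bar q}$; the first four forms are the basic commands.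 Semantics $\llbracket S\rrbracket:\mathcal D(\mathcal H_V)\to\mathcal D(\mathcal H_V)$: $\llbracket\mathbf{skip}\rrbracket(\rho)=\rho$; $\llbracket\bar q:=|0\rangle\rrbracket(\rho)=\sum_{i=0}^{2^t-1}|0\rangle_{\bar q}\langle i|\rho|i\rangle_{\bar q}\langle0|$; $\llbracket\bar q\mathrel{*{=}}U\rrbracket(\rho)=U\rho U^\dagger$; $\llbracket\mathbf{assert}\ P[\bar q]\rrbracket(\rho)=P\rho P$; $\llbracket S_0;S_1\rrbracket=\llbracket S_1\rrbracket\circ\llbracket S_0\rrbracket$; $\llbracket\mathbf{if}\ P[\bar q]\ \mathbf{then}\ S_1\ \mathbf{else}\ S_0\ \mathbf{end}\rrbracket(\rho)=\llbracket\mathbf{assert}\ P[\bar q];S_1\rrbracket(\rho)+\llbracket\mathbf{assert}\ P^\perp[\bar q];S_0\rrbracket(\rho)$; $\llbracket\mathbf{while}\ P[\bar q]\ \mathbf{do}\ S\ \mathbf{end}\rrbracket(\rho)=\sum_{i\ge0}\llbracket(\mathbf{assert}\ P[\bar q];S)^i;\mathbf{assert}\ P^\perp[\bar q]\rrbracket(\rho)$, where $T^i$ is $i$-fold sequential composition ($T^0=\mathbf{skip}$). The concrete domain is $\mathcal Q=2^{\mathcal D(\mathcal H_V)}$ ordered by inclusion, and $\llbracket S\rrbracket(R)=\{\llbracket S\rrbracket(\rho):\rho\in R\}$. A complete lattice $(\mathcal A,\le_{\mathcal A},\vee,\wedge,\bot,\top)$ together with a satisfaction relation $\models\subseteq\mathcal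 D(\mathcal H_V)\times\mathcal A$ such that $a\le_{\mathcal A}a'$ iff every $\rho\models a$ satisfies $\rho\models a'$, is a well-structured set of quantum assertions if (1) whenever $\rho\models a$ for all $a$ in a subset $A\subseteq\mathcal A$, then $\rho\models\bigwedge A$; and (2) for any $a\in\mathcal A$, $\rho_i\in\mathcal D(\mathcal H_V)$, reals $x_i>0$ with $\sum_i x_i\rho_i\in\mathcal D(\mathcal H_V)$: $\sum_i x_i\rho_i\models a$ iff $\rho_i\models a$ for all $i$. $\mathrm{PS}$ is a proof system deriving triples $\{a\}S\{a'\}$ ($a,a'\in\mathcal A$) consisting of an axiom schema for each basic command, one proof rule for each composite construct (sequential composition, conditional, loop), and the consequence rule: from $a\le_{\mathcal A}a'$, $\{a'\}S\{b'\}$, $b'\le_{\mathcal A}b$ infer $\{a\}S\{b\}$; the rule for sequential composition is: from $\{a\}S_0\{a'\}$ and $\{a'\}S_1\{b\}$ infer $\{a\}S_0;S_1\{b\}$. Write $\vdash_{\mathrm{PS}}$ for derivability. Validity: $\models_{\mathrm{PS}}\{a\}S\{a'\}$ iff $\rho\models a$ implies $\llbracket S\rrbracket(\rho)\models a'$ for all $\rho\in\mathcal D(\mathcal H_V)$. $\mathrm{PS}$ is sound if derivable implies valid, relatively complete if valid implies derivable. The induced abstract interpretation: $\gamma(a)=\{\rho:\rho\models a\}$, $\alpha(R)=\bigwedge\{b\in\mathcal A:R\subseteq\gamma(b)\}$ (for $R\in\mathcal Q$), and $\llbracket S\rrbracket^\#(a)=\bigwedge\{a'\in\mathcal A:\vdash_{\mathrm{PS}}\{a\}S\{a'\}\}$.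 An operator $f^\#:\mathcal A\to\mathcal A$ is a sound abstraction of $f:\mathcal Q\to\mathcal Q$ if $\alpha(f(R))\le_{\mathcal A}f^\#(\alpha(R))$ for all $R$, and complete if equality holds for all $R$. *)

theory Defs
  imports Complex_Main
begin

text \<open>Variables form a finite type 'v (the set V = UNIV). The computational basis of H_V
  is indexed by assignments 'v => bool, so operators on H_V are complex matrices indexed by
  assignments.\<close>

type_synonym 'v op = "('v \<Rightarrow> bool) \<Rightarrow> ('v \<Rightarrow> bool) \<Rightarrow> complex"

definition mmul :: "'v::finite op \<Rightarrow> 'v op \<Rightarrow> 'v op" where
  "mmul A B = (\<lambda>s t. \<Sum>k\<in>UNIV. A s k * B k t)"

definition adj :: "'v op \<Rightarrow> 'v op" where
  "adj A = (\<lambda>s t. cnj (A t s))"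

definition madd :: "'v op \<Rightarrow> 'v op \<Rightarrow> 'v op" where
  "madd A B = (\<lambda>s t. A s t + B s t)"

definition conj_by :: "'v::finite op \<Rightarrow> 'v op \<Rightarrow> 'v op" where
  "conj_by K \<rho> = mmul (mmul K \<rho>) (adj K)"

definition mtrace :: "'v::finite op \<Rightarrow> complex" where
  "mtrace A = (\<Sum>s\<in>UNIV. A s s)"

definition positive_op :: "'v::finite op \<Rightarrow> bool" where
  "positive_op A \<longleftrightarrow> (\<forall>\<psi> :: ('v \<Rightarrow> bool) \<Rightarrow> complex.
     let z = (\<Sum>s\<in>UNIV. \<Sum>t\<in>UNIV. cnj (\<psi> s) * A s t * \<psi> t) in Im z = 0 \<and> 0 \<le> Re z)"

definition pdo :: "'v::finite op \<Rightarrow> bool" where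
  "pdo \<rho> \<longleftrightarrow> positive_op \<rho> \<and> Re (mtrace \<rho>) \<le> 1"

text \<open>Basis of H_Q: assignments that are False outside Q.\<close>
definition RQ :: "'v set \<Rightarrow> ('v \<Rightarrow> bool) set" where
  "RQ Q = {s. \<forall>v. v \<notin> Q \<longrightarrow> \<not> s v}"

definition rst :: "'v set \<Rightarrow> ('v \<Rightarrow> bool) \<Rightarrow> ('v \<Rightarrow> bool)" where
  "rst Q s = (\<lambda>v. if v \<in> Q then s v else False)"

text \<open>An operator A on H_Q (only its entries on RQ Q matter) extended to A \<otimes> I on H_V.\<close>
definition cyl :: "'v set \<Rightarrow> 'v op \<Rightarrow> 'v op" where
  "cyl Q A = (\<lambda>s t. if (\<forall>v. v \<notin> Q \<longrightarrow> s v = t v) then A (rst Q s) (rst Q t) else 0)"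

definition unitary_on :: "'v::finite set \<Rightarrow> 'v op \<Rightarrow> bool" where
  "unitary_on Q U \<longleftrightarrow>
     (\<forall>s\<in>RQ Q. \<forall>t\<in>RQ Q. (\<Sum>k\<in>RQ Q. cnj (U k s) * U k t) = (if s = t then 1 else 0)) \<and>
     (\<forall>s\<in>RQ Q. \<forall>t\<in>RQ Q. (\<Sum>k\<in>RQ Q. U s k * cnj (U t k)) = (if s = t then 1 else 0))"

text \<open>Subspaces of H_Q are represented by their orthogonal projectors.\<close>
definition projector_on :: "'v::finite set \<Rightarrow> 'v op \<Rightarrow> bool" where
  "projector_on Q P \<longleftrightarrow>
     (\<forall>s\<in>RQ Q. \<forall>t\<in>RQ Q. P s t = cnj (P t s) \<and> (\<Sum>k\<in>RQ Q. P s k * P k t) = P s t)"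

definition perp :: "'v op \<Rightarrow> 'v op" where
  "perp P = (\<lambda>s t. (if s = t then 1 else 0) - P s t)"

definition ket0bra :: "('v \<Rightarrow> bool) \<Rightarrow> 'v op" where
  "ket0bra i = (\<lambda>a b. if a = (\<lambda>_. False) \<and> b = i then 1 else 0)"

datatype 'v prog =
    Skip
  | Init "'v set"
  | Apply "'v set" "'v op"
  | Assert "'v set" "'v op"
  | Seq "'v prog" "'v prog"
  | If "'v set" "'v op" "'v prog" "'v prog"     (* If Q P S1 S0: then-branch S1, else-branch S0 *)
  | While "'v set" "'v op" "'v prog"

fun basic :: "'v prog \<Rightarrow> bool" where
  "basic Skip = True"
| "basic (Init Q) = True"
| "basic (Apply Q U) = True"
| "basic (Assert Q P) = True"
| "basic _ = False"

fun wf_prog :: "'v::finite prog \<Rightarrow> bool" where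
  "wf_prog Skip = True"
| "wf_prog (Init Q) = (Q \<noteq> {})"
| "wf_prog (Apply Q U) = (Q \<noteq> {} \<and> unitary_on Q U)"
| "wf_prog (Assert Q P) = (Q \<noteq> {} \<and> projector_on Q P)"
| "wf_prog (Seq S0 S1) = (wf_prog S0 \<and> wf_prog S1)"
| "wf_prog (If Q P S1 S0) = (Q \<noteq> {} \<and> projector_on Q P \<and> wf_prog S1 \<and> wf_prog S0)"
| "wf_prog (While Q P S) = (Q \<noteq> {} \<and> projector_on Q P \<and> wf_prog S)"

primrec sem :: "'v::finite prog \<Rightarrow> 'v op \<Rightarrow> 'v op" where
  "sem Skip \<rho> = \<rho>"
| "sem (Init Q) \<rho> = (\<lambda>s t. \<Sum>i\<in>RQ Q. conj_by (cyl Q (ket0bra i)) \<rho> s t)"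
| "sem (Apply Q U) \<rho> = conj_by (cyl Q U) \<rho>"
| "sem (Assert Q P) \<rho> = conj_by (cyl Q P) \<rho>"
| "sem (Seq S0 S1) \<rho> = sem S1 (sem S0 \<rho>)"
| "sem (If Q P S1 S0) \<rho> =
     madd (sem S1 (conj_by (cyl Q P) \<rho>)) (sem S0 (conj_by (cyl Q (perp P)) \<rho>))"
| "sem (While Q P S) \<rho> =
     (\<lambda>s t. \<Sum>n. conj_by (cyl Q (perp P)) (((\<lambda>\<sigma>. sem S (conj_by (cyl Q P) \<sigma>)) ^^ n) \<rho>) s t)"

definition sem_set :: "'v::finite prog \<Rightarrow> 'v op set \<Rightarrow> 'v op set" where
  "sem_set S R = sem S ` R"

definition well_structured :: "('v::finite op \<Rightarrow> 'a::complete_lattice \<Rightarrow> bool) \<Rightarrow> bool" where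
  "well_structured sat \<longleftrightarrow>
     (\<forall>a a'. a \<le> a' \<longleftrightarrow> (\<forall>\<rho>. pdo \<rho> \<longrightarrow> sat \<rho> a \<longrightarrow> sat \<rho> a')) \<and>
     (\<forall>A \<rho>. pdo \<rho> \<longrightarrow> (\<forall>a\<in>A. sat \<rho> a) \<longrightarrow> sat \<rho> (Inf A)) \<and>
     (\<forall>a (I::nat set) \<rho>s x. finite I \<longrightarrow> I \<noteq> {} \<longrightarrow> (\<forall>i\<in>I. pdo (\<rho>s i) \<and> x i > (0::real)) \<longrightarrow>
        pdo (\<lambda>s t. \<Sum>i\<in>I. complex_of_real (x i) * \<rho>s i s t) \<longrightarrow>
        (sat (\<lambda>s t. \<Sum>i\<in>I. complex_of_real (x i) * \<rho>s i s t) a \<longleftrightarrow> (\<forall>i\<in>I. sat (\<rho>s i) a)))"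

text \<open>A proof system PS is given by: the axiom instances ax (only for basic commands),
  the instances of the rule for conditionals ifr (premise triples, conclusion) and of
  the rule for loops whr; the rule for sequential composition and the consequence rule
  are fixed. Premises of the conditional/loop rule are triples about the immediate
  sub-programs.\<close>

inductive derivable ::
  "('a::complete_lattice \<Rightarrow> 'v prog \<Rightarrow> 'a \<Rightarrow> bool)
   \<Rightarrow> (('a \<times> 'v prog \<times> 'a) set \<Rightarrow> 'a \<Rightarrow> 'v set \<Rightarrow> 'v op \<Rightarrow> 'v prog \<Rightarrow> 'v prog \<Rightarrow> 'a \<Rightarrow> bool)
   \<Rightarrow> (('a \<times> 'v prog \<times> 'a) set \<Rightarrow> 'a \<Rightarrow> 'v set \<Rightarrow> 'v op \<Rightarrow> 'v prog \<Rightarrow> 'a \<Rightarrow> bool)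
   \<Rightarrow> 'a \<Rightarrow> 'v prog \<Rightarrow> 'a \<Rightarrow> bool"
  for ax ifr whr where
  axiom: "basic S \<Longrightarrow> ax a S b \<Longrightarrow> derivable ax ifr whr a S b"
| seq: "derivable ax ifr whr a S0 a' \<Longrightarrow> derivable ax ifr whr a' S1 b
        \<Longrightarrow> derivable ax ifr whr a (Seq S0 S1) b"
| cond: "ifr Ps a Q P S1 S0 b \<Longrightarrow>
         (\<forall>p T q. (p, T, q) \<in> Ps \<longrightarrow> (T = S1 \<or> T = S0) \<and> derivable ax ifr whr p T q)
         \<Longrightarrow> derivable ax ifr whr a (If Q P S1 S0) b"
| loop: "whr Ps a Q P S b \<Longrightarrow>
         (\<forall>p T q. (p, T, q) \<in> Ps \<longrightarrow> T = S \<and> derivable ax ifr whr p T q)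
         \<Longrightarrow> derivable ax ifr whr a (While Q P S) b"
| conseq: "a \<le> a' \<Longrightarrow> derivable ax ifr whr a' S b' \<Longrightarrow> b' \<le> b
           \<Longrightarrow> derivable ax ifr whr a S b"

definition valid :: "('v::finite op \<Rightarrow> 'a \<Rightarrow> bool) \<Rightarrow> 'a \<Rightarrow> 'v prog \<Rightarrow> 'a \<Rightarrow> bool" where
  "valid sat a S b \<longleftrightarrow> (\<forall>\<rho>. pdo \<rho> \<longrightarrow> sat \<rho> a \<longrightarrow> sat (sem S \<rho>) b)"

definition PS_sound where
  "PS_sound sat ax ifr whr \<longleftrightarrow>
     (\<forall>S a b. wf_prog S \<longrightarrow> derivable ax ifr whr a S b \<longrightarrow> valid sat a S b)"

definition PS_rel_complete where
  "PS_rel_complete sat ax ifr whr \<longleftrightarrow>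
     (\<forall>S a b. wf_prog S \<longrightarrow> valid sat a S b \<longrightarrow> derivable ax ifr whr a S b)"

definition gamma :: "('v::finite op \<Rightarrow> 'a \<Rightarrow> bool) \<Rightarrow> 'a \<Rightarrow> 'v op set" where
  "gamma sat a = {\<rho>. pdo \<rho> \<and> sat \<rho> a}"

definition alpha :: "('v::finite op \<Rightarrow> 'a::complete_lattice \<Rightarrow> bool) \<Rightarrow> 'v op set \<Rightarrow> 'a" where
  "alpha sat R = Inf {b. R \<subseteq> gamma sat b}"

definition abs_sem where
  "abs_sem ax ifr whr S a = Inf {a'. derivable ax ifr whr a S a'}"

definition sound_abstraction ::
  "('v::finite op set \<Rightarrow> 'a::complete_lattice) \<Rightarrow> ('a \<Rightarrow> 'a) \<Rightarrow> ('v op set \<Rightarrow> 'v op set) \<Rightarrow> bool" where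
  "sound_abstraction \<alpha> f\<^sub>a f \<longleftrightarrow> (\<forall>R. R \<subseteq> {\<rho>. pdo \<rho>} \<longrightarrow> \<alpha> (f R) \<le> f\<^sub>a (\<alpha> R))"

definition complete_abstraction ::
  "('v::finite op set \<Rightarrow> 'a::complete_lattice) \<Rightarrow> ('a \<Rightarrow> 'a) \<Rightarrow> ('v op set \<Rightarrow> 'v op set) \<Rightarrow> bool" where
  "complete_abstraction \<alpha> f\<^sub>a f \<longleftrightarrow> (\<forall>R. R \<subseteq> {\<rho>. pdo \<rho>} \<longrightarrow> \<alpha> (f R) = f\<^sub>a (\<alpha> R))"

end

theory Submission
  imports Defs "HOL-Analysis.Analysis"
begin

text \<open>Soundness only needs that \<open>\<lbrakk>S\<rbrakk>\<close> maps partial density operators to partial density operators.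

  For completeness one must show: if \<open>\<lbrakk>S\<rbrakk>(R) \<subseteq> \<gamma>(b)\<close>, then \<open>{\<alpha>(R)} S {b}\<close> is valid. The assertions in the
  lattice may be too sparse to express the weakest precondition of \<open>b\<close> directly, but relative
  completeness together with the fixed rule for sequential composition supplies one that is good enough.
  The vectors \<open>\<psi>\<close> for which \<open>\<lbrakk>S\<rbrakk>(|\<psi>\<rangle>\<langle>\<psi>|)\<close> satisfies \<open>b\<close> up to scaling form a subspace, by the
  parallelogram identity; let \<open>P\<close> be its projector. Then \<open>{\<top>} assert P; S {b}\<close> is valid, hence derivable,
  hence there is a midpoint \<open>a'\<close> with \<open>{\<top>} assert P {a'}\<close> and \<open>{a'} S {b}\<close> valid. Every \<open>\<rho> \<in> R\<close> is
  supported in \<open>P\<close>, so \<open>\<rho> = P\<rho>P\<close> satisfies \<open>a'\<close>, and therefore \<open>\<alpha>(R) \<le> a'\<close>.\<close>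

subsection \<open>Positive operators\<close>

text \<open>The sesquilinear form \<open><\<psi>|A|\<phi>>\<close>, conjugate-linear on the left;
  its diagonal is the quadratic form inside \<open>positive_op\<close>.\<close>

definition sform :: "'v::finite op \<Rightarrow> (('v \<Rightarrow> bool) \<Rightarrow> complex) \<Rightarrow> (('v \<Rightarrow> bool) \<Rightarrow> complex) \<Rightarrow> complex" where
  "sform A \<psi> \<phi> = (\<Sum>s\<in>UNIV. \<Sum>t\<in>UNIV. cnj (\<psi> s) * A s t * \<phi> t)"

definition delta :: "'a \<Rightarrow> 'a \<Rightarrow> complex" where
  "delta s t = (if t = s then 1 else 0)"

definition outer :: "(('v \<Rightarrow> bool) \<Rightarrow> complex) \<Rightarrow> 'v op" where
  "outer \<psi> = (\<lambda>s t. \<psi> s * cnj (\<psi> t))"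

definition mscale :: "real \<Rightarrow> 'v op \<Rightarrow> 'v op" where
  "mscale c A = (\<lambda>s t. complex_of_real c * A s t)"

definition mzero :: "'v op" where
  "mzero = (\<lambda>s t. 0)"

lemma positive_op_sform:
  "positive_op A \<longleftrightarrow> (\<forall>\<psi>. Im (sform A \<psi> \<psi>) = 0 \<and> 0 \<le> Re (sform A \<psi> \<psi>))"
  by (simp add: positive_op_def sform_def Let_def)

lemma sform_add_left: "sform A (\<lambda>u. \<psi> u + \<phi> u) \<eta> = sform A \<psi> \<eta> + sform A \<phi> \<eta>"
  by (simp add: sform_def algebra_simps sum.distrib)

lemma sform_add_right: "sform A \<eta> (\<lambda>u. \<psi> u + \<phi> u) = sform A \<eta> \<psi> + sform A \<eta> \<phi>"
  by (simp add: sform_def algebra_simps sum.distrib)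

lemma sform_scale_left: "sform A (\<lambda>u. c * \<psi> u) \<eta> = cnj c * sform A \<psi> \<eta>"
  by (simp add: sform_def sum_distrib_left mult_ac)

lemma sform_scale_right: "sform A \<eta> (\<lambda>u. c * \<psi> u) = c * sform A \<eta> \<psi>"
  by (simp add: sform_def sum_distrib_left mult_ac)

lemma sform_delta_left: "sform A (delta s) \<psi> = (\<Sum>t\<in>UNIV. A s t * \<psi> t)"
proof -
  have "sform A (delta s) \<psi> = (\<Sum>u\<in>UNIV. if u = s then (\<Sum>t\<in>UNIV. A s t * \<psi> t) else 0)"
    unfolding sform_def by (intro sum.cong) (auto simp: delta_def)
  then show ?thesis by simp
qed

lemma sform_delta: "sform A (delta s) (delta t) = A s t"
  by (simp add: sform_delta_left delta_def if_distrib cong: if_cong)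

lemma sform_madd: "sform (madd A B) \<psi> \<phi> = sform A \<psi> \<phi> + sform B \<psi> \<phi>"
  by (simp add: sform_def madd_def algebra_simps sum.distrib)

lemma sform_mscale: "sform (mscale c A) \<psi> \<phi> = of_real c * sform A \<psi> \<phi>"
  by (simp add: sform_def mscale_def sum_distrib_left mult_ac)

lemma sform_outer:
  "sform (outer \<psi>) \<eta> \<eta> = of_real ((cmod (\<Sum>s\<in>UNIV. cnj (\<psi> s) * \<eta> s))\<^sup>2)"
proof -
  have "sform (outer \<psi>) \<eta> \<eta> = (\<Sum>s\<in>UNIV. cnj (\<eta> s) * \<psi> s) * (\<Sum>t\<in>UNIV. cnj (\<psi> t) * \<eta> t)"
    unfolding sform_def outer_def sum_product by (simp add: mult_ac)
  also have "\<dots> = cnj (\<Sum>t\<in>UNIV. cnj (\<psi> t) * \<eta> t) * (\<Sum>t\<in>UNIV. cnj (\<psi> t) * \<eta> t)"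
    by (simp add: mult_ac)
  finally show ?thesis unfolding complex_norm_square by (subst mult.commute)
qed

lemma positive_op_madd: "positive_op A \<Longrightarrow> positive_op B \<Longrightarrow> positive_op (madd A B)"
  by (simp add: positive_op_sform sform_madd)

lemma positive_op_mscale: "positive_op A \<Longrightarrow> 0 \<le> c \<Longrightarrow> positive_op (mscale c A)"
  by (simp add: positive_op_sform sform_mscale)

lemma positive_op_outer: "positive_op (outer \<psi>)"
  by (simp add: positive_op_sform sform_outer)

lemma positive_op_mzero: "positive_op mzero"
  by (simp add: positive_op_sform sform_def mzero_def)

text \<open>Polarization: realness of the quadratic form at \<open>\<psi> + \<phi>\<close> settles
  the imaginary parts, at \<open>\<psi> + \<i>\<phi>\<close> the real parts.\<close>

lemma positive_op_hermitian:
  assumes "positive_op A"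
  shows "sform A \<phi> \<psi> = cnj (sform A \<psi> \<phi>)"
proof -
  have im: "Im (sform A \<eta> \<eta>) = 0" for \<eta>
    using assms by (simp add: positive_op_sform)
  have "Im (sform A (\<lambda>u. \<psi> u + \<phi> u) (\<lambda>u. \<psi> u + \<phi> u)) = 0" by (rule im)
  then have 1: "Im (sform A \<psi> \<phi>) + Im (sform A \<phi> \<psi>) = 0"
    by (simp add: sform_add_left sform_add_right im)
  have "Im (sform A (\<lambda>u. \<psi> u + \<i> * \<phi> u) (\<lambda>u. \<psi> u + \<i> * \<phi> u)) = 0" by (rule im)
  then have 2: "Re (sform A \<psi> \<phi>) - Re (sform A \<phi> \<psi>) = 0"
    by (simp add: sform_add_left sform_add_right sform_scale_left sform_scale_right im algebra_simps)
  show ?thesis using 1 2 by (simp add: complex_eq_iff)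
qed

lemma positive_op_entry_cnj: "positive_op A \<Longrightarrow> A t s = cnj (A s t)"
  using positive_op_hermitian[of A "delta t" "delta s"] by (simp add: sform_delta)

lemma positive_op_diag:
  assumes "positive_op A"
  shows "Im (A s s) = 0" "0 \<le> Re (A s s)"
  using assms sform_delta[of A s s] unfolding positive_op_sform by metis+

lemma positive_op_diag_of_real: "positive_op A \<Longrightarrow> A s s = of_real (Re (A s s))"
  by (simp add: complex_eq_iff positive_op_diag)

text \<open>With \<open>z = <\<psi>|A|\<phi>>\<close>, the form at
  \<open>\<phi> - r z \<psi>\<close> is a nonnegative real polynomial in \<open>r\<close> of degree
  at most two. The form may be degenerate, hence the case split on \<open>a = 0\<close>.\<close>

lemma positive_op_cauchy_schwarz:
  assumes "positive_op A"
  shows "(cmod (sform A \<psi> \<phi>))\<^sup>2 \<le> Re (sform A \<psi> \<psi>) * Re (sform A \<phi> \<phi>)"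
proof -
  define a where "a = Re (sform A \<psi> \<psi>)"
  define d where "d = Re (sform A \<phi> \<phi>)"
  define z where "z = sform A \<psi> \<phi>"
  have eq: "sform A \<psi> \<psi> = of_real a" "sform A \<phi> \<phi> = of_real d" "sform A \<phi> \<psi> = cnj z"
    using assms positive_op_hermitian[OF assms, of \<phi> \<psi>]
    by (auto simp: complex_eq_iff a_def d_def z_def positive_op_sform)
  have nn: "0 \<le> a" "0 \<le> d" using assms by (auto simp: a_def d_def positive_op_sform)
  have "0 \<le> r\<^sup>2 * a * (cmod z)\<^sup>2 - 2 * r * (cmod z)\<^sup>2 + d" for r :: real
  proof -
    let ?c = "- of_real r * z"
    let ?x = "\<lambda>u. ?c * \<psi> u + \<phi> u"
    have "sform A ?x ?x = cnj ?c * ?c * a + cnj ?c * z + ?c * cnj z + d"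
      unfolding sform_add_left sform_add_right sform_scale_left sform_scale_right eq z_def[symmetric]
      by (simp add: algebra_simps)
    also have "\<dots> = of_real (r\<^sup>2 * a * (cmod z)\<^sup>2 - 2 * r * (cmod z)\<^sup>2 + d)"
    proof -
      have "complex_of_real ((cmod z)\<^sup>2) = z * cnj z" by (rule complex_norm_square)
      then show ?thesis
        unfolding of_real_add of_real_diff of_real_mult by (simp add: algebra_simps power2_eq_square)
    qed
    finally have "Re (sform A ?x ?x) = r\<^sup>2 * a * (cmod z)\<^sup>2 - 2 * r * (cmod z)\<^sup>2 + d" by (metis Re_complex_of_real)
    moreover have "0 \<le> Re (sform A ?x ?x)" using assms positive_op_sform by blast
    ultimately show ?thesis by simp
  qed note q = this
  show ?thesis
  proof (cases "a = 0")
    case True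
    have "cmod z = 0"
    proof (rule ccontr)
      assume nz: "cmod z \<noteq> 0"
      \<comment> \<open>The polynomial is affine in \<open>r\<close> here; this \<open>r\<close> is
        chosen so that its value is \<open>d - (d + 1) = -1\<close>.\<close>
      have "0 \<le> d - 2 * (((d + 1) / (2 * (cmod z)\<^sup>2)) * (cmod z)\<^sup>2)"
        using q[of "(d + 1) / (2 * (cmod z)\<^sup>2)"] True by (simp only: mult_zero_right mult_zero_left mult.assoc)
      moreover have "((d + 1) / (2 * (cmod z)\<^sup>2)) * (cmod z)\<^sup>2 = (d + 1) / 2"
        using nz by simp
      ultimately show False by simp
    qed
    then show ?thesis using True by (simp add: z_def[symmetric] a_def[symmetric])
  next
    case False
    then have "a > 0" using nn by simp
    \<comment> \<open>The choice \<open>r = 1 / a\<close> minimises the polynomial.\<close>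
    have "0 \<le> d - (cmod z)\<^sup>2 / a"
      using q[of "1 / a"] False by (simp add: power2_eq_square field_simps)
    then show ?thesis using \<open>a > 0\<close>
      by (simp add: z_def[symmetric] a_def[symmetric] d_def[symmetric] field_simps)
  qed
qed

section \<open>Trace bounds and splitting off rank-one summands\<close>

lemma Re_mtrace_nonneg: "positive_op A \<Longrightarrow> 0 \<le> Re (mtrace A)"
  by (simp add: mtrace_def sum_nonneg positive_op_diag)

text \<open>Cauchy-Schwarz on basis vectors bounds an entry by the geometric mean of two diagonal
  entries, each at most the trace. This later dominates the loop series entrywise.\<close>

lemma positive_op_entry_le_trace:
  assumes "positive_op A"
  shows "cmod (A s t) \<le> Re (mtrace A)"
proof -
  have d: "Re (A u u) \<le> Re (mtrace A)" for u
    unfolding mtrace_def Re_sum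
    by (rule member_le_sum) (auto simp: positive_op_diag[OF assms])
  have "(cmod (A s t))\<^sup>2 \<le> Re (A s s) * Re (A t t)"
    using positive_op_cauchy_schwarz[OF assms, of "delta s" "delta t"] by (simp add: sform_delta)
  also have "\<dots> \<le> Re (mtrace A) * Re (mtrace A)"
    by (intro mult_mono d positive_op_diag[OF assms] Re_mtrace_nonneg assms)
  finally show ?thesis
    using Re_mtrace_nonneg[OF assms] by (metis power2_eq_square power2_le_imp_le)
qed

lemma mtrace_madd: "mtrace (madd A B) = mtrace A + mtrace B"
  by (simp add: mtrace_def madd_def sum.distrib)

lemma mtrace_mscale: "mtrace (mscale c A) = of_real c * mtrace A"
  by (simp add: mtrace_def mscale_def sum_distrib_left)

text \<open>One step of Cholesky elimination with pivot \<open>s\<close>: \<open>\<psi>\<close> is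
  column \<open>s\<close>, scaled so that \<open>outer \<psi>\<close> reproduces the entry at
  \<open>(s, s)\<close>. The remainder stays positive by Cauchy-Schwarz against
  \<open>delta s\<close>.\<close>

lemma schur_complement:
  assumes "positive_op A" and "A s s \<noteq> 0"
  defines "\<psi> \<equiv> \<lambda>u. A u s / of_real (sqrt (Re (A s s)))"
  obtains B where "positive_op B" "A = madd (outer \<psi>) B" "B s s = 0"
proof -
  define a where "a = Re (A s s)"
  have a: "A s s = of_real a" using positive_op_diag_of_real[OF assms(1)] by (simp add: a_def)
  have "a > 0" using assms(2) a positive_op_diag(2)[OF assms(1), of s] by (simp add: order_less_le)
  define B where "B = (\<lambda>u t. A u t - \<psi> u * cnj (\<psi> t))"
  have AB: "A = madd (outer \<psi>) B" by (auto simp: madd_def outer_def B_def)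
  have "positive_op B"
    unfolding positive_op_sform
  proof
    fix \<eta>
    have "sform A \<eta> \<eta> = sform (outer \<psi>) \<eta> \<eta> + sform B \<eta> \<eta>"
      by (subst AB) (rule sform_madd)
    moreover
    have "(\<Sum>u\<in>UNIV. cnj (\<psi> u) * \<eta> u) = sform A (delta s) \<eta> / of_real (sqrt a)"
      by (simp add: sform_delta_left \<psi>_def a_def sum_divide_distrib
          positive_op_entry_cnj[OF assms(1), of s, symmetric])
    then have "sform (outer \<psi>) \<eta> \<eta> = of_real ((cmod (sform A (delta s) \<eta>))\<^sup>2 / a)"
      using \<open>a > 0\<close> by (simp add: sform_outer norm_divide power_divide)
    moreover have "(cmod (sform A (delta s) \<eta>))\<^sup>2 / a \<le> Re (sform A \<eta> \<eta>)"
      using positive_op_cauchy_schwarz[OF assms(1), of "delta s" \<eta>] \<open>a > 0\<close>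
      by (simp add: sform_delta a_def[symmetric] field_simps)
    moreover have "Im (sform A \<eta> \<eta>) = 0" using assms(1) by (simp add: positive_op_sform)
    ultimately show "Im (sform B \<eta> \<eta>) = 0 \<and> 0 \<le> Re (sform B \<eta> \<eta>)"
      by auto
  qed
  moreover have "B s s = 0"
  proof -
    have "complex_of_real (sqrt a) * complex_of_real (sqrt a) = of_real a"
      using \<open>a > 0\<close> by (simp flip: of_real_mult)
    then have "\<psi> s * cnj (\<psi> s) = of_real a"
      using \<open>a > 0\<close> unfolding \<psi>_def a Re_complex_of_real by (simp add: divide_simps)
    then show ?thesis by (simp add: B_def a)
  qed
  ultimately show ?thesis by (rule that[OF _ AB])
qed

lemma positive_op_zero_diag:
  assumes "positive_op A" "A s s = 0"
  shows "A s t = 0" "A t s = 0"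
proof -
  have "(cmod (A s t))\<^sup>2 \<le> 0"
    using positive_op_cauchy_schwarz[OF assms(1), of "delta s" "delta t"] assms(2)
    by (simp add: sform_delta)
  then show "A s t = 0" by simp
  then show "A t s = 0" using positive_op_entry_cnj[OF assms(1), of t s] by simp
qed

section \<open>Orthogonal projection onto a complex subspace\<close>

text \<open>Column \<open>t\<close> of \<open>P\<close> is the orthogonal projection of the basis
  vector \<open>t\<close> onto \<open>E\<close>, computed in the real inner product space
  \<open>complex ^ 'b\<close>.\<close>

lemma orthogonal_projector_exists:
  fixes E :: "('b::finite \<Rightarrow> complex) set"
  assumes zero: "(\<lambda>_. 0) \<in> E"
    and add: "\<And>\<psi> \<phi>. \<psi> \<in> E \<Longrightarrow> \<phi> \<in> E \<Longrightarrow> (\<lambda>u. \<psi> u + \<phi> u) \<in> E"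
    and scale: "\<And>c \<psi>. \<psi> \<in> E \<Longrightarrow> (\<lambda>u. c * \<psi> u) \<in> E"
  obtains P where "\<And>t. (\<lambda>s. P s t) \<in> E" "\<And>s t. P s t = cnj (P t s)"
    "\<And>\<psi> s. \<psi> \<in> E \<Longrightarrow> (\<Sum>t\<in>UNIV. P s t * \<psi> t) = \<psi> s"
proof -
  define F where "F = {v :: complex ^ 'b. vec_nth v \<in> E}"
  have subF: "subspace F"
  proof (rule subspaceI)
    show "0 \<in> F" using zero by (simp add: F_def zero_vec_def vec_lambda_inverse)
    show "x + y \<in> F" if "x \<in> F" "y \<in> F" for x y
      using add[of "vec_nth x" "vec_nth y"] that by (simp add: F_def plus_vec_def vec_lambda_inverse)
    show "c *\<^sub>R x \<in> F" if "x \<in> F" for c x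
      using scale[of "vec_nth x" "of_real c"] that
      by (simp add: F_def scaleR_vec_def scaleR_conv_of_real vec_lambda_inverse)
  qed
  then have spF: "span F = F" by (simp add: span_eq_iff)
  have "\<exists>p. p \<in> F \<and> (\<forall>w\<in>F. orthogonal (axis t 1 - p) w)" for t :: 'b
  proof -
    obtain y z where "y \<in> span F" "\<And>w. w \<in> span F \<Longrightarrow> orthogonal z w" "axis t 1 = y + z"
      using orthogonal_subspace_decomp_exists[of F "axis t 1"] by metis
    then have "y \<in> F" "\<forall>w\<in>F. orthogonal (axis t 1 - y) w" by (simp_all add: spF)
    then show ?thesis by blast
  qed
  then obtain p where pF: "\<And>t. p t \<in> F" and po: "\<And>t w. w \<in> F \<Longrightarrow> orthogonal (axis t 1 - p t) w"
    by metis
  define P where "P = (\<lambda>s t. p t $ s)"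
  have inner_Re: "x \<bullet> y = Re (\<Sum>i\<in>UNIV. cnj (y $ i) * x $ i)" for x y :: "complex ^ 'b"
    by (simp add: inner_vec_def inner_complex_def mult.commute)
  \<comment> \<open>The residual \<open>axis t 1 - p t\<close> is orthogonal to \<open>E\<close> in
    the Hermitian sense too. The real inner product sees only the real part of \<open>D\<close>;
    testing against \<open>\<i> * w\<close> as well as \<open>w\<close> kills the imaginary
    part.\<close>
  have key: "(\<Sum>i\<in>UNIV. cnj (w i) * P i t) = cnj (w t)" if "w \<in> E" for w t
  proof -
    define D where "D = (\<Sum>i\<in>UNIV. cnj (w i) * (axis t 1 - p t) $ i)"
    have "(\<chi> i. w i) \<in> F" "(\<chi> i. \<i> * w i) \<in> F"
      using that scale[OF that, of \<i>] by (simp_all add: F_def vec_lambda_inverse)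
    then have "(axis t 1 - p t) \<bullet> (\<chi> i. w i) = 0" "(axis t 1 - p t) \<bullet> (\<chi> i. \<i> * w i) = 0"
      using po by (auto simp: orthogonal_def)
    moreover have "(\<Sum>i\<in>UNIV. cnj (\<i> * w i) * (axis t 1 - p t) $ i) = - \<i> * D"
      unfolding D_def sum_distrib_left by (intro sum.cong) simp_all
    ultimately have "Re D = 0" "Im D = 0"
      unfolding inner_Re vec_lambda_beta by (simp_all add: D_def)
    then have "D = 0" by (simp add: complex_eq_iff)
    moreover have "D = cnj (w t) - (\<Sum>i\<in>UNIV. cnj (w i) * P i t)"
    proof -
      have "D = (\<Sum>i\<in>UNIV. cnj (w i) * ((if i = t then 1 else 0) - P i t))"
        unfolding D_def P_def by (intro sum.cong) (simp_all add: axis_def)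
      also have "\<dots> = (\<Sum>i\<in>UNIV. (if i = t then cnj (w i) else 0) - cnj (w i) * P i t)"
        by (intro sum.cong) (simp_all add: right_diff_distrib)
      finally show ?thesis by (simp add: sum_subtractf)
    qed
    ultimately show ?thesis by simp
  qed
  have PE: "(\<lambda>s. P s t) \<in> E" for t
    using pF[of t] by (simp add: F_def P_def)
  \<comment> \<open>\<open>key\<close> with \<open>w\<close> a column of \<open>P\<close> evaluates
    the inner product of columns \<open>s\<close> and \<open>t\<close> in two ways.\<close>
  have herm: "P s t = cnj (P t s)" for s t
  proof -
    have "P s t = cnj (\<Sum>i\<in>UNIV. cnj (P i t) * P i s)" using key[OF PE, of t s] by simp
    also have "\<dots> = (\<Sum>i\<in>UNIV. cnj (P i s) * P i t)" by (simp add: mult.commute)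
    also have "\<dots> = cnj (P t s)" using key[OF PE, of s t] by simp
    finally show ?thesis .
  qed
  have "(\<Sum>t\<in>UNIV. P s t * \<psi> t) = \<psi> s" if "\<psi> \<in> E" for \<psi> s
  proof -
    have "(\<Sum>t\<in>UNIV. P s t * \<psi> t) = cnj (\<Sum>t\<in>UNIV. cnj (\<psi> t) * P t s)"
      by (subst herm) (simp add: mult.commute)
    also have "\<dots> = \<psi> s" using key[OF that] by simp
    finally show ?thesis .
  qed
  then show ?thesis using that PE herm by blast
qed

subsection \<open>The semantics is linear and trace-nonincreasing\<close>

lemma sform_sum_left:
  "sform A (\<lambda>u. \<Sum>i\<in>I. c i * \<psi> i u) \<phi> = (\<Sum>i\<in>I. cnj (c i) * sform A (\<psi> i) \<phi>)"
proof (induction I rule: infinite_finite_induct)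
  case (insert x F)
  then show ?case by (simp add: sform_add_left sform_scale_left)
qed (simp_all add: sform_def)

lemma sform_sum_right:
  "sform A \<phi> (\<lambda>u. \<Sum>i\<in>I. c i * \<psi> i u) = (\<Sum>i\<in>I. c i * sform A \<phi> (\<psi> i))"
proof (induction I rule: infinite_finite_induct)
  case (insert x F)
  then show ?case by (simp add: sform_add_right sform_scale_right)
qed (simp_all add: sform_def)

text \<open>Reading conjugation as a form on the conjugated rows of \<open>K\<close> lets linearity
  and positivity of \<open>conj_by K\<close> be inherited from \<open>sform\<close>.\<close>

lemma conj_by_entry: "conj_by K A s t = sform A (\<lambda>j. cnj (K s j)) (\<lambda>k. cnj (K t k))"
  unfolding conj_by_def mmul_def adj_def sform_def sum_distrib_right
  by (subst sum.swap) simp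

lemma sform_conj_by:
  "sform (conj_by K A) \<psi> \<phi> =
     sform A (\<lambda>u. \<Sum>s\<in>UNIV. \<psi> s * cnj (K s u)) (\<lambda>u. \<Sum>t\<in>UNIV. \<phi> t * cnj (K t u))"
  unfolding sform_sum_left sform_sum_right sum_distrib_left conj_by_entry[symmetric]
  by (subst (1) sform_def) (simp add: mult_ac)

lemma conj_by_madd: "conj_by K (madd A B) = madd (conj_by K A) (conj_by K B)"
  by (intro ext) (simp add: conj_by_entry sform_madd, simp add: madd_def conj_by_entry)

lemma conj_by_mscale: "conj_by K (mscale c A) = mscale c (conj_by K A)"
  by (intro ext) (simp add: conj_by_entry sform_mscale, simp add: mscale_def conj_by_entry)

lemma positive_op_conj_by: "positive_op A \<Longrightarrow> positive_op (conj_by K A)"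
  by (simp add: positive_op_sform sform_conj_by)

lemma mtrace_conj_by:
  "mtrace (conj_by K A) = (\<Sum>j\<in>UNIV. \<Sum>k\<in>UNIV. A j k * (\<Sum>s\<in>UNIV. cnj (K s k) * K s j))"
proof -
  have "mtrace (conj_by K A) = (\<Sum>s\<in>UNIV. \<Sum>j\<in>UNIV. \<Sum>k\<in>UNIV. A j k * (cnj (K s k) * K s j))"
    by (simp add: mtrace_def conj_by_entry sform_def mult_ac)
  also have "\<dots> = (\<Sum>j\<in>UNIV. \<Sum>s\<in>UNIV. \<Sum>k\<in>UNIV. A j k * (cnj (K s k) * K s j))"
    by (rule sum.swap)
  also have "\<dots> = (\<Sum>j\<in>UNIV. \<Sum>k\<in>UNIV. \<Sum>s\<in>UNIV. A j k * (cnj (K s k) * K s j))"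
    by (intro sum.cong refl sum.swap)
  finally show ?thesis by (simp add: sum_distrib_left)
qed

text \<open>The hypothesis is \<open>\<Sum> K\<dagger>K = I\<close> written entrywise; the trace of
  the conjugates depends on the family only through this sum.\<close>

lemma kraus_trace_preserving:
  assumes "\<And>j k. (\<Sum>i\<in>I. \<Sum>s\<in>UNIV. cnj (K i s k) * K i s j) = (if k = j then 1 else 0)"
  shows "(\<Sum>i\<in>I. mtrace (conj_by (K i) A)) = mtrace A"
proof -
  have "(\<Sum>i\<in>I. mtrace (conj_by (K i) A)) =
      (\<Sum>j\<in>UNIV. \<Sum>i\<in>I. \<Sum>k\<in>UNIV. A j k * (\<Sum>s\<in>UNIV. cnj (K i s k) * K i s j))"
    unfolding mtrace_conj_by by (rule sum.swap)
  also have "\<dots> = (\<Sum>j\<in>UNIV. \<Sum>k\<in>UNIV. \<Sum>i\<in>I. A j k * (\<Sum>s\<in>UNIV. cnj (K i s k) * K i s j))"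
    by (intro sum.cong refl sum.swap)
  also have "\<dots> = (\<Sum>j\<in>UNIV. \<Sum>k\<in>UNIV. A j k * (if k = j then 1 else 0))"
    by (simp flip: sum_distrib_left add: assms)
  also have "\<dots> = mtrace A"
    by (simp add: mtrace_def if_distrib cong: if_cong)
  finally show ?thesis .
qed

section \<open>Gram matrices of cylindrical extensions\<close>

text \<open>Forming \<open>K\<dagger>K\<close> commutes with cylindrical extension: only those
  \<open>s\<close> that agree with \<open>k\<close> and \<open>j\<close> outside \<open>Q\<close>
  contribute, and \<open>rst Q\<close> maps them bijectively onto \<open>RQ Q\<close>.\<close>

lemma gram_cyl:
  fixes Q :: "'v::finite set"
  shows "(\<Sum>s\<in>UNIV. cnj (cyl Q A s k) * cyl Q A s j) =
     (if \<forall>v. v \<notin> Q \<longrightarrow> k v = j v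
      then \<Sum>u\<in>RQ Q. cnj (A u (rst Q k)) * A u (rst Q j) else 0)"
proof (cases "\<forall>v. v \<notin> Q \<longrightarrow> k v = j v")
  case True
  have "(\<Sum>s\<in>UNIV. cnj (cyl Q A s k) * cyl Q A s j) =
      (\<Sum>s\<in>{s. \<forall>v. v \<notin> Q \<longrightarrow> s v = k v}. cnj (cyl Q A s k) * cyl Q A s j)"
    by (intro sum.mono_neutral_right) (auto simp: cyl_def)
  also have "\<dots> = (\<Sum>u\<in>RQ Q. cnj (A u (rst Q k)) * A u (rst Q j))"
  proof (rule sum.reindex_bij_witness[where j = "rst Q" and i = "\<lambda>u v. if v \<in> Q then u v else k v"])
    fix s assume "s \<in> {s. \<forall>v. v \<notin> Q \<longrightarrow> s v = k v}"
    then show "(\<lambda>v. if v \<in> Q then rst Q s v else k v) = s" "rst Q s \<in> RQ Q"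
      "cnj (A (rst Q s) (rst Q k)) * A (rst Q s) (rst Q j) = cnj (cyl Q A s k) * cyl Q A s j"
      using True by (auto simp: rst_def RQ_def cyl_def)
  next
    fix u assume "u \<in> RQ Q"
    then show "rst Q (\<lambda>v. if v \<in> Q then u v else k v) = u"
      by (auto simp: rst_def RQ_def)
  qed auto
  finally show ?thesis using True by simp
next
  case False
  then have "(\<Sum>s\<in>UNIV. cnj (cyl Q A s k) * cyl Q A s j) = 0"
    by (intro sum.neutral ballI) (auto simp: cyl_def)
  then show ?thesis unfolding if_not_P[OF False] .
qed

lemma gram_cyl_sum_identity:
  fixes Q :: "'v::finite set"
  assumes "\<And>s t. s \<in> RQ Q \<Longrightarrow> t \<in> RQ Q \<Longrightarrow>
     (\<Sum>i\<in>I. \<Sum>u\<in>RQ Q. cnj (A i u s) * A i u t) = (if s = t then 1 else 0)"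
  shows "(\<Sum>i\<in>I. \<Sum>s\<in>UNIV. cnj (cyl Q (A i) s k) * cyl Q (A i) s j) = (if k = j then 1 else 0)"
proof (cases "\<forall>v. v \<notin> Q \<longrightarrow> k v = j v")
  case True
  have "rst Q k \<in> RQ Q" "rst Q j \<in> RQ Q" by (auto simp: rst_def RQ_def)
  moreover have "rst Q k = rst Q j \<longleftrightarrow> k = j"
    using True by (auto simp: rst_def fun_eq_iff)
  ultimately show ?thesis using True assms by (simp add: gram_cyl)
next
  case False
  then have "k \<noteq> j" by auto
  then show ?thesis unfolding gram_cyl if_not_P[OF False] by simp
qed

section \<open>Linear maps on the cone of positive operators\<close>

text \<open>Linearity is stated on the positive cone with nonnegative scalars, because that is where
  trace bounds make the loop series converge.\<close>

definition cone_linear :: "('v::finite op \<Rightarrow> 'v op) \<Rightarrow> bool" where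
  "cone_linear f \<longleftrightarrow>
     (\<forall>A. positive_op A \<longrightarrow> positive_op (f A)) \<and>
     (\<forall>A B. positive_op A \<longrightarrow> positive_op B \<longrightarrow> f (madd A B) = madd (f A) (f B)) \<and>
     (\<forall>c A. 0 \<le> c \<longrightarrow> positive_op A \<longrightarrow> f (mscale c A) = mscale c (f A))"

definition trace_nonincreasing :: "('v::finite op \<Rightarrow> 'v op) \<Rightarrow> bool" where
  "trace_nonincreasing f \<longleftrightarrow> (\<forall>A. positive_op A \<longrightarrow> Re (mtrace (f A)) \<le> Re (mtrace A))"

lemma cone_linearD:
  assumes "cone_linear f"
  shows "positive_op A \<Longrightarrow> positive_op (f A)"
    and "positive_op A \<Longrightarrow> positive_op B \<Longrightarrow> f (madd A B) = madd (f A) (f B)"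
    and "0 \<le> c \<Longrightarrow> positive_op A \<Longrightarrow> f (mscale c A) = mscale c (f A)"
  using assms by (auto simp: cone_linear_def)

lemma cone_linear_compose:
  assumes "cone_linear f" "cone_linear g"
  shows "cone_linear (\<lambda>A. f (g A))"
  unfolding cone_linear_def by (simp add: cone_linearD[OF assms(1)] cone_linearD[OF assms(2)])

lemma cone_linear_funpow: "cone_linear f \<Longrightarrow> cone_linear (f ^^ n)"
proof (induction n)
  case 0
  then show ?case by (simp add: cone_linear_def)
next
  case (Suc n)
  then show ?case using cone_linear_compose[of f "f ^^ n"] by (simp add: comp_def)
qed

lemma trace_nonincreasing_compose:
  assumes "trace_nonincreasing f" "trace_nonincreasing g" "cone_linear g"
  shows "trace_nonincreasing (\<lambda>A. f (g A))"
  using assms unfolding trace_nonincreasing_def by (meson cone_linearD(1) order_trans)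

lemma cone_linear_conj_by: "cone_linear (conj_by K)"
  by (simp add: cone_linear_def positive_op_conj_by conj_by_madd conj_by_mscale)

lemma cone_linear_mzero: "cone_linear f \<Longrightarrow> f mzero = mzero"
  using cone_linearD(3)[of f 0 mzero] positive_op_mzero by (simp add: mscale_def mzero_def)

lemma cone_linear_madd:
  assumes "cone_linear f" "cone_linear g"
  shows "cone_linear (\<lambda>A. madd (f A) (g A))"
  unfolding cone_linear_def
proof (intro conjI allI impI)
  fix A B :: "'a op" and c :: real
  assume A: "positive_op A"
  show "positive_op (madd (f A) (g A))"
    by (intro positive_op_madd cone_linearD[OF assms(1)] cone_linearD[OF assms(2)] A)
  show "madd (f (mscale c A)) (g (mscale c A)) = mscale c (madd (f A) (g A))" if "0 \<le> c"
    unfolding cone_linearD(3)[OF assms(1) that A] cone_linearD(3)[OF assms(2) that A]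
    by (simp add: madd_def mscale_def algebra_simps)
  show "madd (f (madd A B)) (g (madd A B)) = madd (madd (f A) (g A)) (madd (f B) (g B))"
    if "positive_op B"
    unfolding cone_linearD(2)[OF assms(1) A that] cone_linearD(2)[OF assms(2) A that]
    by (simp add: madd_def algebra_simps)
qed

lemma cone_linear_sum:
  assumes "\<And>i. i \<in> I \<Longrightarrow> cone_linear (f i)"
  shows "cone_linear (\<lambda>A s t. \<Sum>i\<in>I. f i A s t)"
  using assms
proof (induction I rule: infinite_finite_induct)
  case (insert x F)
  have "(\<lambda>A s t. \<Sum>i\<in>insert x F. f i A s t) = (\<lambda>A. madd (f x A) (\<lambda>s t. \<Sum>i\<in>F. f i A s t))"
    using insert.hyps by (simp add: madd_def fun_eq_iff)
  then show ?case using insert by (simp add: cone_linear_madd)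
qed (simp_all add: cone_linear_def positive_op_mzero[unfolded mzero_def] madd_def mscale_def)

section \<open>Series of cone-linear maps with bounded total trace\<close>

context
  fixes f :: "nat \<Rightarrow> 'v::finite op \<Rightarrow> 'v op"
  assumes lin: "\<And>n. cone_linear (f n)"
    and tr: "\<And>A N. positive_op A \<Longrightarrow> (\<Sum>n<N. Re (mtrace (f n A))) \<le> Re (mtrace A)"
begin

text \<open>Entries are dominated by traces, which are nonnegative and have partial sums bounded by
  the trace of \<open>A\<close>.\<close>

lemma summable_trace_bounded:
  assumes "positive_op A"
  shows "summable (\<lambda>n. f n A s t)"
proof (rule summable_comparison_test')
  show "summable (\<lambda>n. Re (mtrace (f n A)))"
    by (rule summableI_nonneg_bounded)
      (auto intro: Re_mtrace_nonneg cone_linearD(1)[OF lin] assms tr)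
  show "norm (f n A s t) \<le> Re (mtrace (f n A))" if "n \<ge> 0" for n
    by (intro positive_op_entry_le_trace cone_linearD(1)[OF lin] assms)
qed

text \<open>The form is a finite combination of entries, so it commutes with the series and
  positivity passes to the limit; additivity and scaling hold termwise.\<close>

lemma cone_linear_suminf: "cone_linear (\<lambda>A s t. \<Sum>n. f n A s t)"
  unfolding cone_linear_def
proof (intro conjI allI impI)
  fix A B :: "'v op" and c :: real
  assume A: "positive_op A"
  note summable = summable_trace_bounded
  show "positive_op (\<lambda>s t. \<Sum>n. f n A s t)"
    unfolding positive_op_sform
  proof
    fix \<psi>
    have "(\<lambda>n. sform (f n A) \<psi> \<psi>) sums sform (\<lambda>s t. \<Sum>n. f n A s t) \<psi> \<psi>"
      unfolding sform_def
      by (intro sums_sum sums_mult sums_mult2 summable_sums summable A)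
    moreover have pos: "Im (sform (f n A) \<psi> \<psi>) = 0" "0 \<le> Re (sform (f n A) \<psi> \<psi>)" for n
      using cone_linearD(1)[OF lin A] by (auto simp: positive_op_sform)
    ultimately have "(\<lambda>n. 0) sums Im (sform (\<lambda>s t. \<Sum>n. f n A s t) \<psi> \<psi>)"
      and "(\<lambda>n. Re (sform (f n A) \<psi> \<psi>)) sums Re (sform (\<lambda>s t. \<Sum>n. f n A s t) \<psi> \<psi>)"
      by (simp_all add: sums_complex_iff)
    then show "Im (sform (\<lambda>s t. \<Sum>n. f n A s t) \<psi> \<psi>) = 0 \<and>
        0 \<le> Re (sform (\<lambda>s t. \<Sum>n. f n A s t) \<psi> \<psi>)"
      by (intro conjI sums_unique2[OF _ sums_zero] sums_le[OF pos(2) sums_zero])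
  qed
  show "(\<lambda>s t. \<Sum>n. f n (mscale c A) s t) = mscale c (\<lambda>s t. \<Sum>n. f n A s t)" if "0 \<le> c"
  proof -
    have "f n (mscale c A) s t = of_real c * f n A s t" for n s t
      using cone_linearD(3)[OF lin that A] by (simp add: mscale_def)
    then show ?thesis by (simp add: mscale_def suminf_mult[OF summable[OF A]])
  qed
  show "(\<lambda>s t. \<Sum>n. f n (madd A B) s t) = madd (\<lambda>s t. \<Sum>n. f n A s t) (\<lambda>s t. \<Sum>n. f n B s t)"
    if B: "positive_op B"
  proof -
    have "f n (madd A B) s t = f n A s t + f n B s t" for n s t
      using cone_linearD(2)[OF lin A B] by (simp add: madd_def)
    then show ?thesis
      by (simp add: madd_def suminf_add[OF summable[OF A] summable[OF B]])
  qed
qed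

lemma trace_nonincreasing_suminf: "trace_nonincreasing (\<lambda>A s t. \<Sum>n. f n A s t)"
  unfolding trace_nonincreasing_def
proof (intro allI impI)
  fix A :: "'v op"
  assume A: "positive_op A"
  have "(\<lambda>n. mtrace (f n A)) sums mtrace (\<lambda>s t. \<Sum>n. f n A s t)"
    unfolding mtrace_def by (intro sums_sum summable_sums summable_trace_bounded A)
  then have *: "(\<lambda>n. Re (mtrace (f n A))) sums Re (mtrace (\<lambda>s t. \<Sum>n. f n A s t))"
    by (simp add: sums_complex_iff)
  show "Re (mtrace (\<lambda>s t. \<Sum>n. f n A s t)) \<le> Re (mtrace A)"
    using suminf_le_const[OF sums_summable[OF *] tr[OF A]] sums_unique[OF *] by simp
qed

end

section \<open>Trace balance of measurements and initialisation\<close>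

lemma projector_gram:
  assumes "projector_on Q P" "s \<in> RQ Q" "t \<in> RQ Q"
  shows "(\<Sum>u\<in>RQ Q. cnj (P u s) * P u t) = P s t"
    and "(\<Sum>u\<in>RQ Q. cnj (perp P u s) * perp P u t) = perp P s t"
proof -
  have proj: "P a b = cnj (P b a) \<and> (\<Sum>k\<in>RQ Q. P a k * P k b) = P a b"
    if "a \<in> RQ Q" "b \<in> RQ Q" for a b
    by (rule bspec[OF bspec[OF assms(1)[unfolded projector_on_def] that(1)] that(2)])
  have herm: "cnj (P u s) = P s u" if "u \<in> RQ Q" for u
    by (rule conjunct1[OF proj[OF assms(2) that], symmetric])
  have sq: "(\<Sum>u\<in>RQ Q. P s u * P u t) = P s t"
    by (rule conjunct2[OF proj[OF assms(2,3)]])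
  have "(\<Sum>u\<in>RQ Q. cnj (P u s) * P u t) = (\<Sum>u\<in>RQ Q. P s u * P u t)"
    by (intro sum.cong) (simp_all add: herm)
  also note sq
  finally show "(\<Sum>u\<in>RQ Q. cnj (P u s) * P u t) = P s t" .
  \<comment> \<open>Expands \<open>(I - P)(I - P)\<close> as \<open>(I - P) - P + P P\<close>, with
    the identity factors appearing as \<open>if\<close> terms that collapse the sum.\<close>
  have "(\<Sum>u\<in>RQ Q. cnj (perp P u s) * perp P u t) =
      (\<Sum>u\<in>RQ Q. ((if u = s then perp P u t else 0) - (if u = t then P s u else 0)) + P s u * P u t)"
  proof (intro sum.cong refl)
    fix u assume "u \<in> RQ Q"
    then have "cnj (perp P u s) = (if u = s then 1 else 0) - P s u"
      by (simp add: perp_def herm)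
    then show "cnj (perp P u s) * perp P u t =
        (if u = s then perp P u t else 0) - (if u = t then P s u else 0) + P s u * P u t"
      by (simp add: perp_def left_diff_distrib right_diff_distrib)
  qed
  also have "\<dots> = perp P s t"
    using assms(2,3) by (simp add: sum.distrib sum_subtractf sq)
  finally show "(\<Sum>u\<in>RQ Q. cnj (perp P u s) * perp P u t) = perp P s t" .
qed

text \<open>The two outcomes form a Kraus family whose Gram matrices are \<open>P\<close> and
  \<open>perp P\<close>, which add up to the identity.\<close>

lemma mtrace_measure:
  assumes "projector_on Q P"
  shows "mtrace (conj_by (cyl Q P) A) + mtrace (conj_by (cyl Q (perp P)) A) = mtrace A"
proof -
  let ?K = "\<lambda>b. if b then P else perp P"
  have "(\<Sum>b\<in>{True, False}. \<Sum>u\<in>RQ Q. cnj (?K b u s) * ?K b u t) = (if s = t then 1 else 0)"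
    if "s \<in> RQ Q" "t \<in> RQ Q" for s t
    using projector_gram[OF assms that] by (simp add: perp_def)
  then have "(\<Sum>b\<in>{True, False}. mtrace (conj_by (cyl Q (?K b)) A)) = mtrace A"
    by (intro kraus_trace_preserving gram_cyl_sum_identity)
  then show ?thesis by simp
qed

lemma trace_nonincreasing_assert:
  fixes P :: "'a::finite op"
  assumes "projector_on Q P"
  shows "trace_nonincreasing (conj_by (cyl Q P))"
    and "trace_nonincreasing (conj_by (cyl Q (perp P)))"
proof -
  have "Re (mtrace (conj_by (cyl Q P) A)) \<le> Re (mtrace A) \<and>
      Re (mtrace (conj_by (cyl Q (perp P)) A)) \<le> Re (mtrace A)" if "positive_op A" for A
    using arg_cong[OF mtrace_measure[OF assms, of A], of Re]
      Re_mtrace_nonneg[OF positive_op_conj_by[OF that], of "cyl Q P"]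
      Re_mtrace_nonneg[OF positive_op_conj_by[OF that], of "cyl Q (perp P)"]
    unfolding plus_complex.simps by linarith
  then show "trace_nonincreasing (conj_by (cyl Q P))"
    "trace_nonincreasing (conj_by (cyl Q (perp P)))"
    unfolding trace_nonincreasing_def by blast+
qed

text \<open>Each product \<open>|i><0|0><i|\<close> equals \<open>|i><i|\<close>, and these resolve
  the identity.\<close>

lemma ket0bra_gram:
  fixes Q :: "'v::finite set"
  assumes "s \<in> RQ Q" "t \<in> RQ Q"
  shows "(\<Sum>i\<in>RQ Q. \<Sum>u\<in>RQ Q. cnj (ket0bra i u s) * ket0bra i u t) = (if s = t then 1 else 0)"
proof -
  have z: "(\<lambda>_. False) \<in> RQ Q" by (simp add: RQ_def)
  have "(\<Sum>u\<in>RQ Q. cnj (ket0bra i u s) * ket0bra i u t) =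
      (if i = s then if s = t then 1 else 0 else 0)" for i
  proof -
    have "(\<Sum>u\<in>RQ Q. cnj (ket0bra i u s) * ket0bra i u t) =
        (\<Sum>u\<in>RQ Q. if u = (\<lambda>_. False) then if s = i \<and> t = i then 1 else 0 else 0)"
      by (intro sum.cong) (auto simp: ket0bra_def)
    then show ?thesis using z by auto
  qed
  then show ?thesis using assms by simp
qed

text \<open>Both properties go through one induction: linearity of a loop rests on convergence of
  its series, which comes from the trace bound on the body.\<close>

lemma sem_cone_linear_trace_nonincreasing:
  "wf_prog S \<Longrightarrow> cone_linear (sem S) \<and> trace_nonincreasing (sem S)"
proof (induction S)
  case Skip
  then show ?case by (simp add: cone_linear_def trace_nonincreasing_def)
next
  case (Init Q)
  have "mtrace (\<lambda>s t. \<Sum>i\<in>RQ Q. conj_by (cyl Q (ket0bra i)) A s t) = mtrace A" for A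
  proof -
    have "mtrace (\<lambda>s t. \<Sum>i\<in>RQ Q. conj_by (cyl Q (ket0bra i)) A s t) =
        (\<Sum>i\<in>RQ Q. mtrace (conj_by (cyl Q (ket0bra i)) A))"
      unfolding mtrace_def by (rule sum.swap)
    also have "\<dots> = mtrace A"
      by (intro kraus_trace_preserving gram_cyl_sum_identity ket0bra_gram)
    finally show ?thesis .
  qed
  then show ?case
    by (simp add: cone_linear_sum cone_linear_conj_by trace_nonincreasing_def)
next
  case (Apply Q U)
  \<comment> \<open>A unitary counts as a Kraus family with a single member.\<close>
  have "(\<Sum>i\<in>{()}. mtrace (conj_by (cyl Q U) A)) = mtrace A" for A
    using Apply by (intro kraus_trace_preserving gram_cyl_sum_identity) (simp add: unitary_on_def)
  then show ?case
    by (simp add: cone_linear_conj_by[unfolded eta_contract_eq] trace_nonincreasing_def)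
next
  case (Assert Q P)
  then show ?case
    using cone_linear_conj_by[of "cyl Q P"] trace_nonincreasing_assert[of Q P] by simp
next
  case (Seq S0 S1)
  then show ?case by (simp add: cone_linear_compose trace_nonincreasing_compose)
next
  case (If Q P S1 S0)
  then have P: "projector_on Q P" and lin: "cone_linear (sem S1)" "cone_linear (sem S0)"
    and tr: "trace_nonincreasing (sem S1)" "trace_nonincreasing (sem S0)" by auto
  have "trace_nonincreasing (sem (If Q P S1 S0))"
    unfolding trace_nonincreasing_def
  proof (intro allI impI)
    fix A :: "'a op" assume "positive_op A"
    then have "Re (mtrace (sem S1 (conj_by (cyl Q P) A))) \<le> Re (mtrace (conj_by (cyl Q P) A))"
      "Re (mtrace (sem S0 (conj_by (cyl Q (perp P)) A))) \<le> Re (mtrace (conj_by (cyl Q (perp P)) A))"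
      using tr by (simp_all add: trace_nonincreasing_def positive_op_conj_by)
    then show "Re (mtrace (sem (If Q P S1 S0) A)) \<le> Re (mtrace A)"
      by (simp add: mtrace_madd flip: mtrace_measure[OF P, of A])
  qed
  moreover have "sem (If Q P S1 S0) =
      (\<lambda>A. madd (sem S1 (conj_by (cyl Q P) A)) (sem S0 (conj_by (cyl Q (perp P)) A)))"
    by (simp add: fun_eq_iff)
  ultimately show ?case
    by (simp add: lin cone_linear_madd cone_linear_compose cone_linear_conj_by)
next
  case (While Q P S)
  then have P: "projector_on Q P" and lin: "cone_linear (sem S)"
    and tr: "trace_nonincreasing (sem S)" by auto
  define g where "g = (\<lambda>\<sigma>. sem S (conj_by (cyl Q P) \<sigma>))"
  define f where "f = (\<lambda>n A. conj_by (cyl Q (perp P)) ((g ^^ n) A))"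
  have ling: "cone_linear (g ^^ n)" for n
    by (intro cone_linear_funpow) (simp add: g_def cone_linear_compose lin cone_linear_conj_by)
  have linf: "cone_linear (f n)" for n
    by (simp add: f_def cone_linear_compose ling cone_linear_conj_by)
  \<comment> \<open>Adding the trace still inside the loop after \<open>N\<close> rounds makes the
    bound inductive: each round splits that trace between leaving and continuing.\<close>
  have partial: "(\<Sum>n<N. Re (mtrace (f n A))) + Re (mtrace ((g ^^ N) A)) \<le> Re (mtrace A)"
    if "positive_op A" for A N
  proof (induction N)
    case (Suc N)
    have "Re (mtrace ((g ^^ Suc N) A)) \<le> Re (mtrace (conj_by (cyl Q P) ((g ^^ N) A)))"
      using tr cone_linearD(1)[OF ling that]
      by (simp add: g_def trace_nonincreasing_def positive_op_conj_by)
    moreover have "Re (mtrace (conj_by (cyl Q P) ((g ^^ N) A))) + Re (mtrace (f N A))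
        = Re (mtrace ((g ^^ N) A))"
      using arg_cong[OF mtrace_measure[OF P, of "(g ^^ N) A"], of Re] by (simp add: f_def)
    ultimately show ?case using Suc by simp
  qed simp
  have trf: "(\<Sum>n<N. Re (mtrace (f n A))) \<le> Re (mtrace A)" if "positive_op A" for A N
    using partial[OF that, of N] Re_mtrace_nonneg[OF cone_linearD(1)[OF ling[of N] that]] by linarith
  have "sem (While Q P S) = (\<lambda>A s t. \<Sum>n. f n A s t)"
    by (simp add: fun_eq_iff f_def g_def)
  then show ?case
    using cone_linear_suminf[of f, OF linf trf] trace_nonincreasing_suminf[of f, OF linf trf]
    by simp
qed

subsection \<open>Satisfaction and preimages of assertions\<close>

lemma pdo_sem: "wf_prog S \<Longrightarrow> pdo \<rho> \<Longrightarrow> pdo (sem S \<rho>)"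
  using sem_cone_linear_trace_nonincreasing[of S]
  by (auto simp: pdo_def trace_nonincreasing_def intro: cone_linearD(1) order_trans)

lemma mscale_mscale: "mscale c (mscale d A) = mscale (c * d) A"
  by (simp add: mscale_def mult_ac)

lemma mscale_one: "mscale 1 A = A"
  by (simp add: mscale_def)

lemma mscale_madd: "mscale c (madd A B) = madd (mscale c A) (mscale c B)"
  by (simp add: mscale_def madd_def algebra_simps)

lemma pdo_mscale:
  assumes "positive_op A" "0 \<le> c" "c * Re (mtrace A) \<le> 1"
  shows "pdo (mscale c A)"
  using assms by (simp add: pdo_def positive_op_mscale mtrace_mscale)

text \<open>Satisfaction extended from partial density operators to the cone of all positive operators;
  condition (2) of well-structuredness makes the choice of the scaling factor irrelevant.\<close>

definition cone_sat :: "('v::finite op \<Rightarrow> 'a \<Rightarrow> bool) \<Rightarrow> 'v op \<Rightarrow> 'a \<Rightarrow> bool" where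
  "cone_sat sat A a \<longleftrightarrow> (\<exists>c>0. pdo (mscale c A) \<and> sat (mscale c A) a)"

context
  fixes sat :: "'v::finite op \<Rightarrow> 'a::complete_lattice \<Rightarrow> bool"
  assumes ws: "well_structured sat"
begin

lemma sat_Inf: "pdo \<rho> \<Longrightarrow> (\<And>a. a \<in> A \<Longrightarrow> sat \<rho> a) \<Longrightarrow> sat \<rho> (Inf A)"
  using ws[unfolded well_structured_def, THEN conjunct2, THEN conjunct1, rule_format] .

lemma le_iff_sat: "a \<le> a' \<longleftrightarrow> (\<forall>\<rho>. pdo \<rho> \<longrightarrow> sat \<rho> a \<longrightarrow> sat \<rho> a')"
  using ws[unfolded well_structured_def, THEN conjunct1, THEN spec, THEN spec] .

lemma sat_mono: "a \<le> a' \<Longrightarrow> pdo \<rho> \<Longrightarrow> sat \<rho> a \<Longrightarrow> sat \<rho> a'"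
  using le_iff_sat[of a a'] by blast

lemma sat_positive_combination:
  assumes "finite I" "I \<noteq> {}" "\<And>i. i \<in> I \<Longrightarrow> pdo (\<rho> i)" "\<And>i. i \<in> I \<Longrightarrow> x i > 0"
    and "pdo (\<lambda>s t. \<Sum>i\<in>(I::nat set). complex_of_real (x i) * \<rho> i s t)"
  shows "sat (\<lambda>s t. \<Sum>i\<in>I. complex_of_real (x i) * \<rho> i s t) a \<longleftrightarrow> (\<forall>i\<in>I. sat (\<rho> i) a)"
  using assms
  by (intro ws[unfolded well_structured_def, THEN conjunct2, THEN conjunct2, rule_format]) auto

lemma sat_mscale:
  assumes "pdo A" "c > 0" "pdo (mscale c A)"
  shows "sat (mscale c A) a \<longleftrightarrow> sat A a"
  using sat_positive_combination[of "{0}" "\<lambda>_. A" "\<lambda>_. c"] assms by (simp add: mscale_def)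

lemma sat_madd:
  assumes "pdo A" "pdo B" "pdo (madd A B)"
  shows "sat (madd A B) a \<longleftrightarrow> sat A a \<and> sat B a"
  using sat_positive_combination[of "{0, 1}" "\<lambda>i. if i = 0 then A else B" "\<lambda>_. 1"] assms
  by (simp add: madd_def)

lemma cone_sat_iff:
  assumes "c > 0" "pdo (mscale c A)"
  shows "cone_sat sat A a \<longleftrightarrow> sat (mscale c A) a"
proof
  assume "cone_sat sat A a"
  then obtain d where d: "d > 0" "pdo (mscale d A)" "sat (mscale d A) a"
    by (auto simp: cone_sat_def)
  have "mscale c A = mscale (c / d) (mscale d A)" using d by (simp add: mscale_mscale)
  then show "sat (mscale c A) a"
    using d assms sat_mscale[of "mscale d A" "c / d"] by simp
qed (use assms in \<open>auto simp: cone_sat_def\<close>)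

lemma cone_sat_pdo: "pdo A \<Longrightarrow> cone_sat sat A a \<longleftrightarrow> sat A a"
  using cone_sat_iff[of 1 A] by (simp add: mscale_one)

lemma cone_sat_mscale:
  assumes "c > 0"
  shows "cone_sat sat (mscale c A) a \<longleftrightarrow> cone_sat sat A a"
proof
  assume "cone_sat sat (mscale c A) a"
  then obtain d where "d > 0" "pdo (mscale (d * c) A)" "sat (mscale (d * c) A) a"
    by (auto simp: cone_sat_def mscale_mscale)
  then show "cone_sat sat A a" using assms by (auto simp: cone_sat_def intro!: exI[of _ "d * c"])
next
  assume "cone_sat sat A a"
  then obtain d where "d > 0" "pdo (mscale d A)" "sat (mscale d A) a"
    by (auto simp: cone_sat_def)
  then show "cone_sat sat (mscale c A) a"
    using assms by (auto simp: cone_sat_def mscale_mscale intro!: exI[of _ "d / c"])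
qed

lemma cone_sat_madd:
  assumes "positive_op A" "positive_op B"
  shows "cone_sat sat (madd A B) a \<longleftrightarrow> cone_sat sat A a \<and> cone_sat sat B a"
proof -
  \<comment> \<open>One scaling factor that brings \<open>A\<close>, \<open>B\<close> and their sum
    below trace one; the summand 1 keeps the denominator positive.\<close>
  let ?c = "1 / (1 + Re (mtrace A) + Re (mtrace B))"
  have tr: "0 \<le> Re (mtrace A)" "0 \<le> Re (mtrace B)" using assms by (simp_all add: Re_mtrace_nonneg)
  then have c: "?c > 0" by (simp add: add_pos_nonneg)
  have pdo: "pdo (mscale ?c A)" "pdo (mscale ?c B)" "pdo (mscale ?c (madd A B))"
    using c tr by (auto intro!: pdo_mscale positive_op_madd assms simp: mtrace_madd divide_simps)
  then show ?thesis
    using cone_sat_iff[OF c] sat_madd[OF pdo(1,2)] by (simp add: mscale_madd)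
qed

section \<open>The subspace of pure states sent into an assertion\<close>

context
  fixes f :: "'v op \<Rightarrow> 'v op" and b :: 'a
  assumes lin: "cone_linear f" and zero: "sat mzero b"
begin

text \<open>The vectors are not normalised, hence \<open>cone_sat\<close> in place of
  \<open>sat\<close>; this is what allows the set to be a linear subspace.\<close>

definition pure_preimage :: "(('v \<Rightarrow> bool) \<Rightarrow> complex) set" where
  "pure_preimage = {\<psi>. cone_sat sat (f (outer \<psi>)) b}"

lemma cone_sat_mzero: "cone_sat sat mzero b"
proof -
  have "pdo (mzero :: 'v op)"
    by (simp add: pdo_def positive_op_mzero) (simp add: mtrace_def mzero_def)
  then show ?thesis using zero by (simp add: cone_sat_pdo)
qed

lemma pure_preimage_zero: "(\<lambda>_. 0) \<in> pure_preimage"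
proof -
  have "outer (\<lambda>_. 0) = (mzero :: 'v op)" by (simp add: outer_def mzero_def)
  then show ?thesis
    by (simp add: pure_preimage_def cone_linear_mzero[OF lin] cone_sat_mzero)
qed

lemma pure_preimage_scale:
  assumes "\<psi> \<in> pure_preimage"
  shows "(\<lambda>u. c * \<psi> u) \<in> pure_preimage"
proof (cases "c = 0")
  case True
  then show ?thesis using pure_preimage_zero by simp
next
  case False
  have "outer (\<lambda>u. c * \<psi> u) = mscale ((cmod c)\<^sup>2) (outer \<psi>)"
    by (simp only: outer_def mscale_def complex_norm_square) (simp add: mult_ac)
  then show ?thesis
    using assms False
    by (simp add: pure_preimage_def cone_linearD(3)[OF lin] positive_op_outer cone_sat_mscale)
qed

text \<open>Parallelogram identity: \<open>|\<psi>+\<phi>\<rangle>\<langle>\<psi>+\<phi>| + |\<psi>-\<phi>\<rangle>\<langle>\<psi>-\<phi>| = 2|\<psi>\<rangle>\<langle>\<psi>| + 2|\<phi>\<rangle>\<langle>\<phi>|\<close>, and satisfaction passes to summands.\<close>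

lemma pure_preimage_add:
  assumes "\<psi> \<in> pure_preimage" "\<phi> \<in> pure_preimage"
  shows "(\<lambda>u. \<psi> u + \<phi> u) \<in> pure_preimage"
proof -
  let ?p = "outer (\<lambda>u. \<psi> u + \<phi> u)" and ?m = "outer (\<lambda>u. \<psi> u - \<phi> u)"
  have "madd ?p ?m = mscale 2 (madd (outer \<psi>) (outer \<phi>))"
    by (simp add: madd_def outer_def mscale_def algebra_simps)
  then have "f (madd ?p ?m) = f (mscale 2 (madd (outer \<psi>) (outer \<phi>)))" by (rule arg_cong)
  then have "madd (f ?p) (f ?m) = mscale 2 (madd (f (outer \<psi>)) (f (outer \<phi>)))"
    by (simp add: cone_linearD(2,3)[OF lin] positive_op_outer positive_op_madd)
  moreover have "cone_sat sat (mscale 2 (madd (f (outer \<psi>)) (f (outer \<phi>)))) b"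
    using assms
    by (simp add: cone_sat_mscale cone_sat_madd cone_linearD(1)[OF lin] positive_op_outer pure_preimage_def)
  ultimately have "cone_sat sat (madd (f ?p) (f ?m)) b" by simp
  then show ?thesis
    by (simp add: cone_sat_madd cone_linearD(1)[OF lin] positive_op_outer pure_preimage_def)
qed

lemma pure_preimage_sum:
  assumes "\<And>i. i \<in> I \<Longrightarrow> \<psi> i \<in> pure_preimage"
  shows "(\<lambda>u. \<Sum>i\<in>I. c i * \<psi> i u) \<in> pure_preimage"
  using assms
proof (induction I rule: infinite_finite_induct)
  case (insert x F)
  then show ?case
    using pure_preimage_add[OF pure_preimage_scale[of "\<psi> x" "c x"], of "\<lambda>u. \<Sum>i\<in>F. c i * \<psi> i u"]
    by simp
qed (simp_all add: pure_preimage_zero)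

text \<open>Up to a scalar, a nonzero column spans the rank-one summand split off by
  \<open>schur_complement\<close>, and satisfaction passes to summands.\<close>

lemma column_in_pure_preimage:
  assumes A: "positive_op A" and sat: "cone_sat sat (f A) b"
  shows "(\<lambda>u. A u s) \<in> pure_preimage"
proof (cases "A s s = 0")
  case True
  then show ?thesis using positive_op_zero_diag(2)[of A s, OF A True] pure_preimage_zero by simp
next
  case False
  let ?\<psi> = "\<lambda>u. A u s / of_real (sqrt (Re (A s s)))"
  obtain B where B: "positive_op B" and eq: "A = madd (outer ?\<psi>) B"
  proof (rule schur_complement[of A s, OF A False])
    fix B assume "positive_op B" "A = madd (outer ?\<psi>) B"
    then show thesis by (rule that)
  qed
  have "f A = madd (f (outer ?\<psi>)) (f B)"
    by (rule trans[OF arg_cong[OF eq, of f] cone_linearD(2)[OF lin positive_op_outer B]])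
  then have "cone_sat sat (f (outer ?\<psi>)) b"
    using sat by (simp add: cone_sat_madd cone_linearD(1)[OF lin] positive_op_outer B)
  then have \<psi>: "?\<psi> \<in> pure_preimage" by (simp add: pure_preimage_def)
  have "Re (A s s) \<noteq> 0" using False positive_op_diag(1)[OF A, of s] by (simp add: complex_eq_iff)
  then show ?thesis using pure_preimage_scale[OF \<psi>, of "of_real (sqrt (Re (A s s)))"] by simp
qed

text \<open>Rank-one summands are peeled off one at a time. The remainder's columns are combinations
  of columns of \<open>A\<close>, so they stay in the subspace, and its diagonal has fewer nonzero
  entries.\<close>

lemma cone_sat_if_columns_in_pure_preimage:
  assumes "positive_op A" "\<And>s. (\<lambda>u. A u s) \<in> pure_preimage"
  shows "cone_sat sat (f A) b"
  using assms
proof (induction "card {s. A s s \<noteq> 0}" arbitrary: A rule: less_induct)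
  case less
  show ?case
  proof (cases "\<exists>s. A s s \<noteq> 0")
    case False
    then have "A = mzero"
      using positive_op_zero_diag(1)[of A] less.prems(1) by (auto simp: mzero_def fun_eq_iff)
    then show ?thesis by (simp add: cone_linear_mzero[OF lin] cone_sat_mzero)
  next
    case True
    then obtain s where s: "A s s \<noteq> 0" by blast
    define \<psi> where "\<psi> = (\<lambda>u. A u s / of_real (sqrt (Re (A s s))))"
    obtain B where B: "positive_op B" and eq: "A = madd (outer \<psi>) B" and Bss: "B s s = 0"
    proof (rule schur_complement[of A s, OF less.prems(1) s])
      fix B assume "positive_op B" "A = madd (outer (\<lambda>u. A u s / of_real (sqrt (Re (A s s))))) B"
        "B s s = 0"
      then show thesis by (rule that[unfolded \<psi>_def])
    qed
    have Bst: "B u t = A u t - \<psi> u * cnj (\<psi> t)" for u t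
      using fun_cong[OF fun_cong[OF eq, of u], of t] by (simp add: madd_def outer_def)
    have \<psi>: "\<psi> \<in> pure_preimage"
      using pure_preimage_scale[OF less.prems(2)[of s], of "1 / of_real (sqrt (Re (A s s)))"]
      by (simp add: \<psi>_def)
    have columns: "(\<lambda>u. B u t) \<in> pure_preimage" for t
      using pure_preimage_add[OF less.prems(2)[of t] pure_preimage_scale[OF \<psi>, of "- cnj (\<psi> t)"]]
      by (simp add: Bst mult.commute)
    have "card {t. B t t \<noteq> 0} < card {t. A t t \<noteq> 0}"
    proof (rule psubset_card_mono)
      \<comment> \<open>A zero diagonal entry forces its whole row to vanish, so elimination creates
        no new nonzero diagonal entries, while the pivot \<open>s\<close> disappears.\<close>
      have "\<psi> t = 0" if "A t t = 0" for t
        using positive_op_zero_diag(1)[of A t s, OF less.prems(1) that] by (simp add: \<psi>_def)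
      then have "B t t = 0" if "A t t = 0" for t using that by (simp add: Bst)
      then show "{t. B t t \<noteq> 0} \<subset> {t. A t t \<noteq> 0}"
        using s Bss by blast
    qed simp
    from this B columns have "cone_sat sat (f B) b" by (rule less.hyps)
    moreover have "f A = madd (f (outer \<psi>)) (f B)"
      by (rule trans[OF arg_cong[OF eq, of f] cone_linearD(2)[OF lin positive_op_outer B]])
    ultimately show ?thesis
      using \<psi> by (simp add: cone_sat_madd cone_linearD(1)[OF lin] positive_op_outer B pure_preimage_def)
  qed
qed

text \<open>\<open>P\<close> projects onto \<open>pure_preimage\<close>. The columns of
  \<open>P \<rho> P\<close> are combinations of columns of \<open>P\<close>; conversely, if
  \<open>f \<rho>\<close> satisfies \<open>b\<close>, the columns of \<open>\<rho>\<close> lie in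
  the subspace and \<open>P\<close> fixes them.\<close>

lemma preimage_projector:
  obtains P where "projector_on UNIV P"
    "\<And>\<rho>. positive_op \<rho> \<Longrightarrow> cone_sat sat (f (conj_by (cyl UNIV P) \<rho>)) b"
    "\<And>\<rho>. positive_op \<rho> \<Longrightarrow> cone_sat sat (f \<rho>) b \<Longrightarrow> conj_by (cyl UNIV P) \<rho> = \<rho>"
proof -
  obtain P :: "'v op" where P: "\<And>t. (\<lambda>s. P s t) \<in> pure_preimage"
      "\<And>s t. P s t = cnj (P t s)"
    and fix_P: "\<And>\<psi> s. \<psi> \<in> pure_preimage \<Longrightarrow> (\<Sum>t\<in>UNIV. P s t * \<psi> t) = \<psi> s"
  proof (rule orthogonal_projector_exists[OF pure_preimage_zero pure_preimage_add pure_preimage_scale])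
    fix P :: "'v op"
    assume "\<And>t. (\<lambda>s. P s t) \<in> pure_preimage" "\<And>s t. P s t = cnj (P t s)"
      "\<And>\<psi> s. \<psi> \<in> pure_preimage \<Longrightarrow> (\<Sum>t\<in>UNIV. P s t * \<psi> t) = \<psi> s"
    then show thesis by (rule that)
  qed
  have cyl: "cyl UNIV P = P" by (simp add: cyl_def rst_def)
  have conj: "conj_by P \<rho> s t = (\<Sum>j\<in>UNIV. (\<Sum>k\<in>UNIV. P s k * \<rho> k j) * P j t)" for \<rho> s t
    by (simp add: P(2)[symmetric] conj_by_def mmul_def adj_def)
  show ?thesis
  proof
    show "projector_on UNIV P"
      unfolding projector_on_def using fix_P[OF P(1)] by (simp add: RQ_def P(2)[symmetric])
  next
    fix \<rho> :: "'v op"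
    assume \<rho>: "positive_op \<rho>"
    show "cone_sat sat (f (conj_by (cyl UNIV P) \<rho>)) b"
    proof (rule cone_sat_if_columns_in_pure_preimage)
      show "positive_op (conj_by (cyl UNIV P) \<rho>)" by (rule positive_op_conj_by[OF \<rho>])
      fix t
      have "(\<lambda>s. conj_by P \<rho> s t) = (\<lambda>s. \<Sum>k\<in>UNIV. (\<Sum>j\<in>UNIV. \<rho> k j * P j t) * P s k)"
        unfolding conj sum_distrib_right by (subst sum.swap) (simp add: mult_ac)
      then show "(\<lambda>s. conj_by (cyl UNIV P) \<rho> s t) \<in> pure_preimage"
        using pure_preimage_sum[of UNIV "\<lambda>k s. P s k"] P(1) by (simp add: cyl)
    qed
  next
    fix \<rho> :: "'v op"
    assume \<rho>: "positive_op \<rho>" and "cone_sat sat (f \<rho>) b"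
    then have left: "(\<Sum>k\<in>UNIV. P s k * \<rho> k j) = \<rho> s j" for s j
      by (intro fix_P column_in_pure_preimage)
    \<comment> \<open>\<open>\<rho> P = \<rho>\<close> is the adjoint of
      \<open>P \<rho> = \<rho>\<close>, both operators being Hermitian.\<close>
    have "(\<Sum>j\<in>UNIV. \<rho> s j * P j t) = \<rho> s t" for s t
    proof -
      have "(\<Sum>j\<in>UNIV. \<rho> s j * P j t) = cnj (\<Sum>j\<in>UNIV. P t j * \<rho> j s)"
        by (simp add: positive_op_entry_cnj[OF \<rho>, symmetric] P(2)[symmetric] mult.commute)
      also have "\<dots> = cnj (\<rho> t s)" unfolding left ..
      also have "\<dots> = \<rho> s t" by (rule positive_op_entry_cnj[OF \<rho>, symmetric])
      finally show ?thesis .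
    qed
    then show "conj_by (cyl UNIV P) \<rho> = \<rho>"
      by (simp add: cyl fun_eq_iff conj left)
  qed
qed

end

text \<open>Condition (1) of well-structuredness, applied to all assertions that hold throughout
  \<open>R\<close>, gives \<open>R \<subseteq> \<gamma>(\<alpha>(R))\<close>.\<close>

lemma sat_alpha:
  assumes "R \<subseteq> {\<rho>. pdo \<rho>}" "\<rho> \<in> R"
  shows "sat \<rho> (alpha sat R)"
  unfolding alpha_def using assms by (intro sat_Inf) (auto simp: gamma_def)

end

section \<open>Inverting derivations; soundness and completeness of the abstraction\<close>

text \<open>Such a derivation is one use of the sequential rule followed by consequence steps; these
  are absorbed by strengthening the precondition of \<open>S0\<close> and weakening the
  postcondition of \<open>S1\<close>.\<close>

lemma derivable_Seq_midpoint:
  assumes "derivable ax ifr whr a (Seq S0 S1) b"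
  obtains a' where "derivable ax ifr whr a S0 a'" "derivable ax ifr whr a' S1 b"
proof -
  have "\<exists>a'. derivable ax ifr whr a S0 a' \<and> derivable ax ifr whr a' S1 b"
    using assms
  proof (induction a "Seq S0 S1" b rule: derivable.induct)
    case (conseq a a' b' b)
    then show ?case by (meson derivable.conseq order_refl)
  qed auto
  then show ?thesis using that by blast
qed

theorem mainTheorem12:
  fixes sat :: "'v::finite op \<Rightarrow> 'a::complete_lattice \<Rightarrow> bool"
    and ax :: "'a \<Rightarrow> 'v prog \<Rightarrow> 'a \<Rightarrow> bool"
    and ifr :: "('a \<times> 'v prog \<times> 'a) set \<Rightarrow> 'a \<Rightarrow> 'v set \<Rightarrow> 'v op \<Rightarrow> 'v prog \<Rightarrow> 'v prog \<Rightarrow> 'a \<Rightarrow> bool"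
    and whr :: "('a \<times> 'v prog \<times> 'a) set \<Rightarrow> 'a \<Rightarrow> 'v set \<Rightarrow> 'v op \<Rightarrow> 'v prog \<Rightarrow> 'a \<Rightarrow> bool"
  assumes "well_structured sat"
  shows "(PS_sound sat ax ifr whr \<longrightarrow>
            (\<forall>S. wf_prog S \<longrightarrow>
               sound_abstraction (alpha sat) (abs_sem ax ifr whr S) (sem_set S)))
       \<and> (PS_sound sat ax ifr whr \<and> PS_rel_complete sat ax ifr whr \<longrightarrow>
            (\<forall>S. wf_prog S \<longrightarrow>
               complete_abstraction (alpha sat) (abs_sem ax ifr whr S) (sem_set S)))"
proof -
  note ws = assms
  \<comment> \<open>Every derivable postcondition is valid, hence among the assertions whose meet is
    \<open>\<alpha>\<close> of the image.\<close>
  have sound: "alpha sat (sem_set S R) \<le> abs_sem ax ifr whr S (alpha sat R)"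
    if "PS_sound sat ax ifr whr" "wf_prog S" "R \<subseteq> {\<rho>. pdo \<rho>}" for S R
    unfolding abs_sem_def
  proof (rule Inf_greatest)
    fix a' assume "a' \<in> {a'. derivable ax ifr whr (alpha sat R) S a'}"
    then have "valid sat (alpha sat R) S a'" using that by (simp add: PS_sound_def)
    then have "sem_set S R \<subseteq> gamma sat a'"
      using that(2,3) sat_alpha[OF ws that(3)] pdo_sem[OF that(2)]
      by (auto simp: sem_set_def gamma_def valid_def)
    then show "alpha sat (sem_set S R) \<le> a'"
      unfolding alpha_def by (intro Inf_lower) simp
  qed
  have valid: "valid sat (alpha sat R) S b"
    if snd: "PS_sound sat ax ifr whr" and cpl: "PS_rel_complete sat ax ifr whr"
      and wf: "wf_prog S" and R: "R \<subseteq> {\<rho>. pdo \<rho>}" and sub: "sem_set S R \<subseteq> gamma sat b" for S R b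
  proof (cases "\<exists>\<rho>. pdo \<rho> \<and> sat \<rho> b")
    case False
    \<comment> \<open>Possible, because condition (2) only concerns nonempty sums: not even the zero operator need satisfy \<open>b\<close>.\<close>
    then have "R = {}" using sub by (auto simp: sem_set_def gamma_def)
    then have "alpha sat R \<le> b" unfolding alpha_def by (intro Inf_lower) simp
    \<comment> \<open>A state satisfying \<open>alpha sat R\<close> would satisfy \<open>b\<close>,
      so the triple holds vacuously.\<close>
    then show ?thesis using False sat_mono[OF ws] by (auto simp: valid_def)
  next
    case True
    then obtain \<rho>0 where \<rho>0: "pdo \<rho>0" "sat \<rho>0 b" by blast
    \<comment> \<open>Splitting off the zero operator as a summand of \<open>\<rho>0\<close>
      transfers satisfaction of \<open>b\<close> to it.\<close>
    have "madd mzero \<rho>0 = \<rho>0" by (simp add: madd_def mzero_def)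
    moreover have pdo0: "pdo (mzero :: 'v op)"
      by (simp add: pdo_def positive_op_mzero) (simp add: mtrace_def mzero_def)
    ultimately have zero: "sat mzero b" using sat_madd[OF ws, of mzero \<rho>0 b] \<rho>0 by simp
    have lin: "cone_linear (sem S)" using sem_cone_linear_trace_nonincreasing[OF wf] by simp
    obtain P where P: "projector_on UNIV P"
      and into: "\<And>\<rho>. positive_op \<rho> \<Longrightarrow> cone_sat sat (sem S (conj_by (cyl UNIV P) \<rho>)) b"
      and fixed: "\<And>\<rho>. positive_op \<rho> \<Longrightarrow> cone_sat sat (sem S \<rho>) b \<Longrightarrow> conj_by (cyl UNIV P) \<rho> = \<rho>"
      using preimage_projector[OF ws lin zero] by metis
    let ?T = "Assert UNIV P"
    have wfT: "wf_prog ?T" "wf_prog (Seq ?T S)" using P wf by simp_all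
    have "valid sat top (Seq ?T S) b"
      unfolding valid_def
    proof (intro allI impI)
      fix \<rho> :: "'v op" assume \<rho>: "pdo \<rho>"
      then have "cone_sat sat (sem (Seq ?T S) \<rho>) b" using into by (simp add: pdo_def)
      then show "sat (sem (Seq ?T S) \<rho>) b"
        using cone_sat_pdo[OF ws pdo_sem[OF wfT(2) \<rho>]] by blast
    qed
    then have "derivable ax ifr whr top (Seq ?T S) b"
      using cpl wfT(2) unfolding PS_rel_complete_def by blast
    then obtain a' where "derivable ax ifr whr top ?T a'" "derivable ax ifr whr a' S b"
      by (rule derivable_Seq_midpoint)
    then have T: "valid sat top ?T a'" and S: "valid sat a' S b"
      using snd wf wfT(1) unfolding PS_sound_def by blast+
    have "\<rho> \<in> gamma sat a'" if "\<rho> \<in> R" for \<rho>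
    proof -
      have \<rho>: "pdo \<rho>" using that R by blast
      have "sat (sem S \<rho>) b" using that sub by (auto simp: sem_set_def gamma_def)
      then have "sem ?T \<rho> = \<rho>"
        using fixed[of \<rho>] \<rho> cone_sat_pdo[OF ws pdo_sem[OF wf \<rho>]] by (simp add: pdo_def)
      \<comment> \<open>Here \<open>top\<close> is the meet of the empty set, so condition (1)
        applies with no premises.\<close>
      moreover have "sat \<rho> top" using sat_Inf[OF ws \<rho>, of "{}"] by simp
      ultimately have "sat \<rho> a'" using T \<rho> unfolding valid_def by metis
      then show ?thesis using \<rho> by (simp add: gamma_def)
    qed
    then have "alpha sat R \<le> a'" unfolding alpha_def by (intro Inf_lower) blast
    then show ?thesis using S sat_mono[OF ws] unfolding valid_def by blast
  qed
  \<comment> \<open>Each \<open>b\<close> in the meet defining \<open>\<alpha>\<close> of the image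
    is a derivable postcondition of \<open>\<alpha>(R)\<close>, by \<open>valid\<close> and relative
    completeness.\<close>
  have complete: "abs_sem ax ifr whr S (alpha sat R) \<le> alpha sat (sem_set S R)"
    if "PS_sound sat ax ifr whr" "PS_rel_complete sat ax ifr whr" "wf_prog S"
      "R \<subseteq> {\<rho>. pdo \<rho>}" for S R
    unfolding alpha_def[of sat "sem_set S R"]
  proof (rule Inf_greatest)
    fix b assume "b \<in> {b. sem_set S R \<subseteq> gamma sat b}"
    then have "derivable ax ifr whr (alpha sat R) S b"
      using valid[OF that, of b] that(2,3) unfolding PS_rel_complete_def by blast
    then show "abs_sem ax ifr whr S (alpha sat R) \<le> b"
      unfolding abs_sem_def by (intro Inf_lower) simp
  qed
  show ?thesis
    unfolding sound_abstraction_def complete_abstraction_def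
    using sound complete by (blast intro: antisym)
qed

end
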